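(* Let $\Omega\subset\mathbb R^k\times\mathbb R^l$ be open, let $u\in\mathcal E^{k,l,\mathbb R}_\Omega$, and suppose the map $(x,y)\mapsto(x,u_y(x,y))$ is injective on $\Omega$, so that the partial Legendre transform $\mathcal{PL}_{k,l}u=w(x,z)$ is defined on the image $\hat\Omega$. Then, with the left side evaluated at $(x,z)=(x,u_y(x,y))$ and the right side at $(x,y)$, $$D^2\mathcal{PL}_{k,l}u=\begin{pmatrix}u_{xx}-u_{xy}u_{yy}^{-1}u_{yx}&u_{xy}u_{yy}^{-1}\\ u_{yy}^{-1}u_{yx}&-u_{yy}^{-1}\end{pmatrix}\ge0.$$ Moreover $$\det D^2\mathcal{PL}_{k,l}u=\frac{\det u_{xx}}{\det(-u_{yy})}.$$
   Context: $(x,y)$ are coordinates on $\mathbb R^k\times\mathbb R^l$. $u_{xx}=(u_{x_ix_j})$ is $k\times k$, $u_{xy}=(u_{x_iy_j})$ is $k\times l$, $u_{yx}=u_{xy}^T$, and $u_{yy}=(u_{y_iy_j})$ is $l\times l$. $\mathcal E^{k,l,\mathbb R}_\Omega$ is the set of $u\in C^\infty(\Omega)$ with $u_{xx}>0$ and $u_{yy}<0$ (as matrices) everywhere on $\Omega$. The partial Legendre transform $\mathcal{PL}_{k,l}u$ is the function $w$ defined on $\hat\Omega=\{(x,u_y(x,y)):(x,y)\in\Omega\}$ by $w(x,z)=u(x,y(x,z))-\langle y(x,z),z\rangle$, where $y(x,z)$ is the $y$ with $(x,y)\in\Omega$ and $\frac{\partial u}{\partial y}(x,y)=z$. $D^2w$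 is its Hessian in the coordinates $(x,z)$. *)

theory Defs
  imports "HOL-Analysis.Analysis"
begin

section \<open>Partial derivatives and smoothness\<close>

definition partial_deriv :: "'a::real_normed_vector \<Rightarrow> ('a \<Rightarrow> real) \<Rightarrow> 'a \<Rightarrow> real" where
  "partial_deriv b f p = frechet_derivative f (at p) b"

text \<open>
  The functions below are total, but only their values on the set \<open>S\<close> matter when \<open>S\<close> is open,
  which is the only case in which the following notions are used. A function is \<open>C\<close>-\<open>(n+1)\<close> on
  \<open>S\<close> iff it is differentiable on \<open>S\<close> and all its first partial derivatives are \<open>C\<close>-\<open>n\<close> on \<open>S\<close>.
\<close>

fun Cn_on :: "nat \<Rightarrow> 'a::euclidean_space set \<Rightarrow> ('a \<Rightarrow> real) \<Rightarrow> bool" where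
  "Cn_on 0 S f \<longleftrightarrow> continuous_on S f"
| "Cn_on (Suc n) S f \<longleftrightarrow>
     (\<forall>p\<in>S. f differentiable (at p)) \<and> (\<forall>b\<in>Basis. Cn_on n S (partial_deriv b f))"

definition smooth_on :: "'a::euclidean_space set \<Rightarrow> ('a \<Rightarrow> real) \<Rightarrow> bool" where
  "smooth_on S f \<longleftrightarrow> (\<forall>n. Cn_on n S f)"

definition twice_differentiable_on :: "'a::euclidean_space set \<Rightarrow> ('a \<Rightarrow> real) \<Rightarrow> bool" where
  "twice_differentiable_on S f \<longleftrightarrow>
     (\<forall>p\<in>S. f differentiable (at p) \<and> (\<forall>b\<in>Basis. partial_deriv b f differentiable (at p)))"


section \<open>Matrices\<close>

definition pos_definite :: "real^'n^'n \<Rightarrow> bool" where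
  "pos_definite A \<longleftrightarrow> transpose A = A \<and> (\<forall>v. v \<noteq> 0 \<longrightarrow> v \<bullet> (A *v v) > 0)"

definition neg_definite :: "real^'n^'n \<Rightarrow> bool" where
  "neg_definite A \<longleftrightarrow> transpose A = A \<and> (\<forall>v. v \<noteq> 0 \<longrightarrow> v \<bullet> (A *v v) < 0)"

definition pos_semidefinite :: "real^'n^'n \<Rightarrow> bool" where
  "pos_semidefinite A \<longleftrightarrow> transpose A = A \<and> (\<forall>v. v \<bullet> (A *v v) \<ge> 0)"

text \<open>The block matrix with rows \<open>(A B)\<close> and \<open>(C D)\<close>.\<close>

definition block_matrix ::
  "real^'k^'k \<Rightarrow> real^'l^'k \<Rightarrow> real^'k^'l \<Rightarrow> real^'l^'l \<Rightarrow> real^('k+'l)^('k+'l)" where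
  "block_matrix A B C D =
     (\<chi> a b. case a of
        Inl i \<Rightarrow> (case b of Inl j \<Rightarrow> A $ i $ j | Inr j \<Rightarrow> B $ i $ j)
      | Inr i \<Rightarrow> (case b of Inl j \<Rightarrow> C $ i $ j | Inr j \<Rightarrow> D $ i $ j))"


section \<open>Derivatives in the coordinates of a product\<close>

definition ex :: "'k \<Rightarrow> (real^'k) \<times> (real^'l)" where
  "ex i = (axis i 1, 0)"

definition ey :: "'l \<Rightarrow> (real^'k) \<times> (real^'l)" where
  "ey j = (0, axis j 1)"

definition grad_y :: "((real^'k) \<times> (real^'l) \<Rightarrow> real) \<Rightarrow> (real^'k) \<times> (real^'l) \<Rightarrow> real^'l" where
  "grad_y u p = (\<chi> j. partial_deriv (ey j) u p)"

text \<open>The entry \<open>(i, j)\<close> differentiates first in the \<open>i\<close>-th and then in the \<open>j\<close>-th direction.\<close>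

definition D2xx :: "((real^'k) \<times> (real^'l) \<Rightarrow> real) \<Rightarrow> (real^'k) \<times> (real^'l) \<Rightarrow> real^'k^'k" where
  "D2xx u p = (\<chi> i j. partial_deriv (ex j) (partial_deriv (ex i) u) p)"

definition D2xy :: "((real^'k) \<times> (real^'l) \<Rightarrow> real) \<Rightarrow> (real^'k) \<times> (real^'l) \<Rightarrow> real^'l^'k" where
  "D2xy u p = (\<chi> i j. partial_deriv (ey j) (partial_deriv (ex i) u) p)"

definition D2yx :: "((real^'k) \<times> (real^'l) \<Rightarrow> real) \<Rightarrow> (real^'k) \<times> (real^'l) \<Rightarrow> real^'k^'l" where
  "D2yx u p = transpose (D2xy u p)"

definition D2yy :: "((real^'k) \<times> (real^'l) \<Rightarrow> real) \<Rightarrow> (real^'k) \<times> (real^'l) \<Rightarrow> real^'l^'l" where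
  "D2yy u p = (\<chi> i j. partial_deriv (ey j) (partial_deriv (ey i) u) p)"

text \<open>The full Hessian; the coordinates of the product are indexed by \<^typ>\<open>'k + 'l\<close>.\<close>

definition coord_vec :: "'k + 'l \<Rightarrow> (real^'k) \<times> (real^'l)" where
  "coord_vec a = (case a of Inl i \<Rightarrow> ex i | Inr j \<Rightarrow> ey j)"

definition hessian ::
  "((real^'k) \<times> (real^'l) \<Rightarrow> real) \<Rightarrow> (real^'k) \<times> (real^'l) \<Rightarrow> real^('k+'l)^('k+'l)" where
  "hessian f p = (\<chi> a b. partial_deriv (coord_vec b) (partial_deriv (coord_vec a) f) p)"


section \<open>The partial Legendre transform\<close>

definition E_class :: "((real^'k) \<times> (real^'l)) set \<Rightarrow> ((real^'k) \<times> (real^'l) \<Rightarrow> real) set" where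
  "E_class \<Omega> = {u. smooth_on \<Omega> u \<and> (\<forall>p\<in>\<Omega>. pos_definite (D2xx u p) \<and> neg_definite (D2yy u p))}"

definition legendre_map ::
  "((real^'k) \<times> (real^'l) \<Rightarrow> real) \<Rightarrow> (real^'k) \<times> (real^'l) \<Rightarrow> (real^'k) \<times> (real^'l)" where
  "legendre_map u = (\<lambda>(x, y). (x, grad_y u (x, y)))"

text \<open>
  The transform is meaningful only on \<open>legendre_map u ` \<Omega>\<close> and only if \<open>legendre_map u\<close> is
  injective on \<open>\<Omega>\<close>; elsewhere the values are unspecified.
\<close>

definition partial_legendre ::
  "((real^'k) \<times> (real^'l)) set \<Rightarrow> ((real^'k) \<times> (real^'l) \<Rightarrow> real) \<Rightarrow> (real^'k) \<times> (real^'l) \<Rightarrow> real"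
  where
  "partial_legendre \<Omega> u = (\<lambda>(x, z).
     let y = (THE y. (x, y) \<in> \<Omega> \<and> grad_y u (x, y) = z) in u (x, y) - y \<bullet> z)"

end

theory Submission
  imports Defs
begin

text \<open>
  Write \<open>F (x, y) = (x, u\<^sub>y (x, y))\<close>, \<open>w\<close> for the transform, and \<open>y (x, z)\<close> for the second component
  of the inverse of \<open>F\<close>. Everything follows from the two formulas
  \<open>w\<^sub>x (x, z) = u\<^sub>x (x, y (x, z))\<close> and \<open>w\<^sub>z (x, z) = - y (x, z)\<close>: in the differential of
  \<open>w = u - y \<bullet> z\<close> the terms containing \<open>dy\<close> cancel, because \<open>u\<^sub>y = z\<close>
  (\<open>has_derivative_partial_legendre\<close>). So a single derivative of \<open>F\<^sup>-\<^sup>1\<close> already gives second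
  derivatives of \<open>w\<close>. Differentiating \<open>u\<^sub>y (x, y (x, z)) = z\<close> yields
  \<open>dy = u\<^sub>y\<^sub>y\<^sup>-\<^sup>1 (dz - u\<^sub>y\<^sub>x dx)\<close>, and substituting this into the differentials of \<open>u\<^sub>x\<close> and \<open>- y\<close>
  gives the four blocks of the Hessian (\<open>hessian_partial_legendre\<close>).

  The inverse is known to exist globally, so the only missing regularity is its continuity and the
  openness of the image; both come from invariance of domain. With them, the derivative of \<open>F\<close>,
  which is invertible because \<open>u\<^sub>y\<^sub>y\<close> is definite, may be inverted at each point. The derivative
  of \<open>u\<^sub>y\<close> in the \<open>x\<close> directions is the transpose of \<open>u\<^sub>x\<^sub>y\<close> by the symmetry of second derivatives
  (\<open>partial_deriv_commute\<close>).

  The rest is linear algebra for \<open>A = u\<^sub>x\<^sub>x > 0\<close>, \<open>B = u\<^sub>x\<^sub>y\<close> and \<open>J = u\<^sub>y\<^sub>y\<^sup>-\<^sup>1 < 0\<close>: completing the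
  square shows that the block matrix is positive semidefinite
  (\<open>pos_semidefinite_legendre_block\<close>), and one block row operation makes it triangular, with
  determinant \<open>det A det (- J)\<close> (\<open>det_legendre_block\<close>).
\<close>

section \<open>Block matrices\<close>

lemma sum_UNIV_Plus:
  fixes g :: "'a::finite + 'b::finite \<Rightarrow> 'c::comm_monoid_add"
  shows "(\<Sum>a\<in>UNIV. g a) = (\<Sum>i\<in>UNIV. g (Inl i)) + (\<Sum>j\<in>UNIV. g (Inr j))"
  by (simp flip: UNIV_Plus_UNIV add: sum.Plus)

lemma block_matrix_nth [simp]:
  "block_matrix A B C D $ Inl i $ Inl j = A $ i $ j"
  "block_matrix A B C D $ Inl i $ Inr j' = B $ i $ j'"
  "block_matrix A B C D $ Inr i' $ Inl j = C $ i' $ j"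
  "block_matrix A B C D $ Inr i' $ Inr j' = D $ i' $ j'"
  by (simp_all add: block_matrix_def)

lemma eq_block_matrix_iff:
  "H = block_matrix A B C D \<longleftrightarrow>
     (\<forall>i j. H $ Inl i $ Inl j = A $ i $ j) \<and> (\<forall>i j. H $ Inl i $ Inr j = B $ i $ j) \<and>
     (\<forall>i j. H $ Inr i $ Inl j = C $ i $ j) \<and> (\<forall>i j. H $ Inr i $ Inr j = D $ i $ j)"
  by (auto simp: vec_eq_iff split_sum_all)

lemma block_matrix_mult:
  "block_matrix A B C D ** block_matrix A' B' C' D' =
     block_matrix (A ** A' + B ** C') (A ** B' + B ** D') (C ** A' + D ** C') (C ** B' + D ** D')"
  by (simp add: eq_block_matrix_iff matrix_matrix_mult_def sum_UNIV_Plus)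

lemma transpose_block_matrix:
  "transpose (block_matrix A B C D) =
     block_matrix (transpose A) (transpose C) (transpose B) (transpose D)"
  by (simp add: eq_block_matrix_iff transpose_def)

lemma inner_block_matrix:
  fixes v :: "real^('k::finite + 'l::finite)"
  defines "l \<equiv> \<chi> i. v $ Inl i" and "r \<equiv> \<chi> j. v $ Inr j"
  shows "v \<bullet> (block_matrix A B C D *v v) = l \<bullet> (A *v l + B *v r) + r \<bullet> (C *v l + D *v r)"
  by (simp add: inner_vec_def matrix_vector_mult_def sum_UNIV_Plus l_def r_def)

lemma matrix_mult_uminus:
  fixes A :: "'a::ring_1^'n^'m" and B :: "'a^'p^'n"
  shows "(- A) ** B = - (A ** B)" "A ** (- B) = - (A ** B)"
  by (simp_all add: vec_eq_iff matrix_matrix_mult_def sum_negf)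

lemma transpose_diff: "transpose (A - B) = transpose A - transpose B"
  by (simp add: vec_eq_iff transpose_def)

lemma transpose_uminus: "transpose (- A) = - transpose A"
  by (simp add: vec_eq_iff transpose_def)

lemma uminus_matrix_vector_mult:
  fixes A :: "'a::ring_1^'n^'m"
  shows "(- A) *v x = - (A *v x)" "A *v (- x) = - (A *v x)"
  by (simp_all add: vec_eq_iff matrix_vector_mult_def sum_negf)

lemma matrix_vector_mult_axis_nth:
  fixes A :: "real^'n^'m"
  shows "(A *v axis j 1) $ i = A $ i $ j"
  by (simp add: matrix_vector_mult_basis column_def)

text \<open>
  In the Leibniz formula a permutation contributes only if it fixes every index whose row is a row
  of the identity, so that it amounts to a permutation of the remaining indices. All block
  determinants below rest on this.
\<close>

lemma det_identity_rows:
  fixes M :: "'a::comm_ring_1^'n^'n" and f :: "'k::finite \<Rightarrow> 'n::finite"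
  assumes f: "inj f" and rows: "\<And>a. a \<notin> range f \<Longrightarrow> M $ a = axis a 1"
  shows "det M = det (\<chi> i j. M $ f i $ f j)"
proof -
  let ?t = "\<lambda>p. of_int (sign p) * (\<Prod>a\<in>UNIV. M $ a $ p a)"
  have "det M = sum ?t {p. p permutes range f}"
    unfolding det_def
  proof (rule sum.mono_neutral_right)
    show "\<forall>p\<in>{p. p permutes UNIV} - {p. p permutes range f}. ?t p = 0"
    proof
      fix p :: "'n \<Rightarrow> 'n"
      assume p: "p \<in> {p. p permutes UNIV} - {p. p permutes range f}"
      then have "\<exists>a. a \<notin> range f \<and> p a \<noteq> a"
        using permutes_superset[of p UNIV "range f"] by auto
      then obtain a where "a \<notin> range f" "p a \<noteq> a"
        by blast
      then have "M $ a $ p a = 0"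
        by (simp add: rows axis_def)
      then have "(\<Prod>a\<in>UNIV. M $ a $ p a) = 0"
        by (intro prod_zero) auto
      then show "?t p = 0"
        by simp
    qed
  qed (auto intro: permutes_subset simp: finite_permutations)
  also have "\<dots> = (\<Sum>q | q permutes UNIV. of_int (sign q) * (\<Prod>i\<in>UNIV. M $ f i $ f (q i)))"
  proof (rule sym, rule sum.reindex_bij_witness
      [where i = "map_permutation (range f) (inv f)" and j = "map_permutation UNIV f"])
    fix q :: "'k \<Rightarrow> 'k"
    assume "q \<in> {q. q permutes UNIV}"
    then have q: "q permutes UNIV"
      by simp
    let ?p = "map_permutation UNIV f q"
    have fq: "?p (f i) = f (q i)" for i
      by (simp add: map_permutation_apply f)
    show "map_permutation (range f) (inv f) ?p = q"
      by (rule map_permutation_compose_inv) (use f q in \<open>auto simp: bij_betw_def\<close>)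
    have p: "?p permutes range f"
      by (rule map_permutation_permutes) (use f q in \<open>auto simp: bij_betw_def\<close>)
    then show "?p \<in> {p. p permutes range f}"
      by simp
    have "(\<Prod>a\<in>UNIV. M $ a $ ?p a) = (\<Prod>a\<in>range f. M $ a $ ?p a)"
      by (rule prod.mono_neutral_right)
        (auto simp: rows axis_def permutes_not_in[OF p])
    also have "\<dots> = (\<Prod>i\<in>UNIV. M $ f i $ f (q i))"
      by (simp add: prod.reindex f fq)
    finally show "?t ?p = of_int (sign q) * (\<Prod>i\<in>UNIV. M $ f i $ f (q i))"
      by (simp add: sign_map_permutation f q)
  next
    fix p :: "'n \<Rightarrow> 'n"
    assume "p \<in> {p. p permutes range f}"
    then have p: "p permutes range f"
      by simp
    have bij: "bij_betw (inv f) (range f) UNIV"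
      using f by (simp add: inj_imp_bij_betw_inv)
    show "map_permutation UNIV f (map_permutation (range f) (inv f) p) = p"
      by (rule map_permutation_compose_inv[OF bij p]) (auto simp: f_inv_into_f)
    show "map_permutation (range f) (inv f) p \<in> {q. q permutes UNIV}"
      using map_permutation_permutes[OF bij p] by simp
  qed
  also have "\<dots> = det (\<chi> i j. M $ f i $ f j)"
    by (simp add: det_def)
  finally show ?thesis .
qed

lemma det_block_identity_lower: "det (block_matrix A B 0 (mat 1)) = det A"
proof -
  have "det (block_matrix A B 0 (mat 1)) =
      det (\<chi> i j. block_matrix A B 0 (mat 1) $ Inl i $ Inl j)"
  proof (rule det_identity_rows)
    fix a :: "'a + 'b"
    assume "a \<notin> range Inl"
    then show "block_matrix A B 0 (mat 1) $ a = axis a 1"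
      by (cases a) (auto simp: vec_eq_iff split_sum_all axis_def mat_def)
  qed simp
  then show ?thesis
    by simp
qed

lemma det_block_identity_upper: "det (block_matrix (mat 1) 0 C D) = det D"
proof -
  have "det (block_matrix (mat 1) 0 C D) =
      det (\<chi> i j. block_matrix (mat 1) 0 C D $ Inr i $ Inr j)"
  proof (rule det_identity_rows)
    fix a :: "'a + 'b"
    assume "a \<notin> range Inr"
    then show "block_matrix (mat 1) 0 C D $ a = axis a 1"
      by (cases a) (auto simp: vec_eq_iff split_sum_all axis_def mat_def)
  qed simp
  then show ?thesis
    by simp
qed

lemma det_block_lower_triangular: "det (block_matrix A 0 C D) = det A * det D"
proof -
  have "block_matrix A 0 C D = block_matrix A 0 0 (mat 1) ** block_matrix (mat 1) 0 C D"
    by (simp add: block_matrix_mult)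
  then show ?thesis
    by (simp add: det_mul det_block_identity_lower det_block_identity_upper)
qed


section \<open>The block matrix of the transform\<close>

lemma matrix_inv_inverse:
  assumes "invertible A"
  shows "A ** matrix_inv A = mat 1" "matrix_inv A ** A = mat 1"
proof -
  have "A ** matrix_inv A = mat 1 \<and> matrix_inv A ** A = mat 1"
    unfolding matrix_inv_def by (rule someI_ex) (use assms in \<open>simp add: invertible_def\<close>)
  then show "A ** matrix_inv A = mat 1" "matrix_inv A ** A = mat 1"
    by auto
qed

lemma neg_definite_invertible:
  assumes "neg_definite A"
  shows "invertible A"
proof -
  have "\<forall>v. A *v v = 0 \<longrightarrow> v = 0"
    using assms by (metis inner_zero_right less_irrefl neg_definite_def)
  then show ?thesis
    by (simp add: invertible_left_inverse matrix_left_invertible_ker)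
qed

lemma neg_definite_matrix_inv:
  assumes "neg_definite A"
  shows "neg_definite (matrix_inv A)"
proof -
  note inv = matrix_inv_inverse[OF neg_definite_invertible[OF assms]]
  let ?J = "matrix_inv A"
  have sym: "transpose A = A" and neg: "\<And>v. v \<noteq> 0 \<Longrightarrow> v \<bullet> (A *v v) < 0"
    using assms by (auto simp: neg_definite_def)
  have "transpose ?J ** A = mat 1"
    by (metis inv(1) matrix_transpose_mul sym transpose_mat)
  then have "transpose ?J = ?J"
    by (metis inv(1) matrix_mul_assoc matrix_mul_lid matrix_mul_rid)
  moreover have "v \<bullet> (?J *v v) < 0" if "v \<noteq> 0" for v
  proof -
    have v: "A *v (?J *v v) = v"
      by (simp add: matrix_vector_mul_assoc inv)
    with that have "?J *v v \<noteq> 0"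
      by (metis matrix_vector_mult_0_right)
    from neg[OF this] show ?thesis
      by (simp add: v inner_commute)
  qed
  ultimately show ?thesis
    by (simp add: neg_definite_def)
qed

text \<open>
  Eliminating the corner \<open>B J\<close> with the last row block leaves a triangular matrix with \<open>A\<close> and
  \<open>- J\<close> on the diagonal.
\<close>

lemma det_legendre_block:
  "det (block_matrix (A - B ** J ** C) (B ** J) (J ** C) (- J)) = det A * det (- J)"
proof -
  have "block_matrix (A - B ** J ** C) (B ** J) (J ** C) (- J) =
      block_matrix (mat 1) (- B) 0 (mat 1) ** block_matrix A 0 (J ** C) (- J)"
    by (simp add: block_matrix_mult matrix_mul_assoc matrix_mult_uminus)
  then show ?thesis
    by (simp add: det_mul det_block_identity_lower det_block_lower_triangular)
qed

text \<open>
  Completing the square, the quadratic form at \<open>(l, r)\<close> is the value of \<open>A\<close> at \<open>l\<close> minus the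
  value of \<open>J\<close> at \<open>C l - r\<close>, where \<open>C\<close> is the transpose of \<open>B\<close>.
\<close>

lemma pos_semidefinite_legendre_block:
  assumes A: "pos_definite A" and J: "neg_definite J"
  shows "pos_semidefinite
    (block_matrix (A - B ** J ** transpose B) (B ** J) (J ** transpose B) (- J))"
  unfolding pos_semidefinite_def
proof (intro conjI allI)
  have sym: "transpose A = A" "transpose J = J"
    using A J by (auto simp: pos_definite_def neg_definite_def)
  show "transpose (block_matrix (A - B ** J ** transpose B) (B ** J) (J ** transpose B) (- J)) =
      block_matrix (A - B ** J ** transpose B) (B ** J) (J ** transpose B) (- J)"
    by (simp add: transpose_block_matrix transpose_diff transpose_uminus matrix_transpose_mul sym
        matrix_mul_assoc)
next
  fix v :: "real^('a + 'b)"
  define l r where "l = (\<chi> i. v $ Inl i)" and "r = (\<chi> j. v $ Inr j)"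
  define c where "c = l v* B"
  have B: "l \<bullet> (B *v x) = c \<bullet> x" for x
    by (simp add: c_def dot_lmul_matrix)
  have "v \<bullet> (block_matrix (A - B ** J ** transpose B) (B ** J) (J ** transpose B) (- J) *v v) =
      l \<bullet> (A *v l) - c \<bullet> (J *v c) + c \<bullet> (J *v r) + r \<bullet> (J *v c) - r \<bullet> (J *v r)"
    by (simp add: inner_block_matrix l_def [symmetric] r_def [symmetric] c_def [symmetric] B
        uminus_matrix_vector_mult inner_add_right inner_diff_right matrix_vector_mult_diff_rdistrib
        flip: matrix_vector_mul_assoc)
  also have "\<dots> = l \<bullet> (A *v l) - (c - r) \<bullet> (J *v (c - r))"
    by (simp add: inner_diff_left inner_diff_right matrix_vector_mult_diff_distrib)
  also have "\<dots> \<ge> 0"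
  proof -
    have "0 \<le> l \<bullet> (A *v l)"
      using A by (cases "l = 0") (auto simp: pos_definite_def intro: less_imp_le)
    moreover have "(c - r) \<bullet> (J *v (c - r)) \<le> 0"
      using J by (cases "c - r = 0") (auto simp: neg_definite_def intro: less_imp_le)
    ultimately show ?thesis
      by simp
  qed
  finally show "0 \<le> v \<bullet>
      (block_matrix (A - B ** J ** transpose B) (B ** J) (J ** transpose B) (- J) *v v)" .
qed


section \<open>Partial derivatives\<close>

lemma partial_deriv_eq: "(f has_derivative f') (at p) \<Longrightarrow> partial_deriv b f p = f' b"
  unfolding partial_deriv_def by (metis frechet_derivative_at)

lemma coord_vec_simps [simp]: "coord_vec (Inl i) = ex i" "coord_vec (Inr j) = ey j"
  by (simp_all add: coord_vec_def)

lemma ex_ey_components: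
  "fst (ex i) = axis i 1" "snd (ex i) = 0" "fst (ey j) = 0" "snd (ey j) = axis j 1"
  by (simp_all add: ex_def ey_def)

lemma Basis_eq_range_coord_vec: "Basis = range coord_vec"
  by (auto simp: Basis_prod_def Basis_vec_def ex_def ey_def UNIV_sum image_Un image_image)

lemma coord_vec_in_Basis: "ex i \<in> Basis" "ey j \<in> Basis"
  by (auto simp: Basis_prod_def Basis_vec_def ex_def ey_def)

lemma frechet_derivative_eq_partial_derivs:
  assumes "f differentiable (at p)"
  shows "frechet_derivative f (at p) (h, m) =
    (\<Sum>i\<in>UNIV. partial_deriv (ex i) f p * h $ i) + (\<Sum>j\<in>UNIV. partial_deriv (ey j) f p * m $ j)"
proof -
  let ?D = "frechet_derivative f (at p)"
  have lin: "linear ?D"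
    using assms by (rule linear_frechet_derivative)
  have h: "(\<Sum>i\<in>UNIV. h $ i *\<^sub>R axis i 1) = h" and m: "(\<Sum>j\<in>UNIV. m $ j *\<^sub>R axis j 1) = m"
    using basis_expansion[of h] basis_expansion[of m] by (simp_all add: scalar_mult_eq_scaleR)
  have "(h, m) = (\<Sum>i\<in>UNIV. h $ i *\<^sub>R ex i) + (\<Sum>j\<in>UNIV. m $ j *\<^sub>R ey j)"
    by (rule prod_eqI) (simp_all add: fst_sum snd_sum ex_ey_components h m)
  then show ?thesis
    by (simp add: lin linear_add linear_sum linear_scale partial_deriv_def mult.commute)
qed

lemma DERIV_along_line:
  assumes "f differentiable (at (q + s *\<^sub>R a))"
  shows "((\<lambda>s. f (q + s *\<^sub>R a)) has_real_derivative partial_deriv a f (q + s *\<^sub>R a)) (at s)"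
proof -
  let ?D = "frechet_derivative f (at (q + s *\<^sub>R a))"
  have "(f has_derivative ?D) (at (q + s *\<^sub>R a))"
    using assms by (simp add: frechet_derivative_works)
  moreover have "((\<lambda>s. q + s *\<^sub>R a) has_derivative (\<lambda>t. t *\<^sub>R a)) (at s)"
    by (auto intro!: derivative_eq_intros)
  ultimately have "((\<lambda>s. f (q + s *\<^sub>R a)) has_derivative (\<lambda>t. ?D (t *\<^sub>R a))) (at s)"
    by (rule has_derivative_compose[rotated])
  moreover have "?D (t *\<^sub>R a) = partial_deriv a f (q + s *\<^sub>R a) * t" for t
    using linear_scale[OF linear_frechet_derivative[OF assms]] by (simp add: partial_deriv_def)
  ultimately show ?thesis
    by (simp add: has_field_derivative_def)
qed

text \<open>
  Two applications of the mean value theorem, first in direction \<open>a\<close> to a difference in direction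
  \<open>b\<close> and then in direction \<open>b\<close>, express the second difference by a second derivative at an
  unknown nearby point. The left-hand side is symmetric in \<open>a\<close> and \<open>b\<close>.
\<close>

lemma second_difference_mean_value:
  assumes h: "0 < h" and a: "norm a \<le> 1" and b: "norm b \<le> 1"
    and sub: "cball p (2 * h) \<subseteq> S"
    and f: "\<And>q. q \<in> S \<Longrightarrow> f differentiable (at q)"
    and fa: "\<And>q. q \<in> S \<Longrightarrow> partial_deriv a f differentiable (at q)"
  shows "\<exists>q\<in>cball p (2 * h). f (p + h *\<^sub>R a + h *\<^sub>R b) - f (p + h *\<^sub>R a) - f (p + h *\<^sub>R b) + f p =
    h * h * partial_deriv b (partial_deriv a f) q"
proof -
  have near: "p + s *\<^sub>R a + t *\<^sub>R b \<in> cball p (2 * h)" if "0 \<le> s" "s \<le> h" "0 \<le> t" "t \<le> h" for s t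
  proof -
    have "norm (s *\<^sub>R a + t *\<^sub>R b) \<le> s * norm a + t * norm b"
      using norm_triangle_ineq[of "s *\<^sub>R a" "t *\<^sub>R b"] that by simp
    also have "\<dots> \<le> h * 1 + h * 1"
      using that a b by (intro add_mono mult_mono) auto
    also have "norm (s *\<^sub>R a + t *\<^sub>R b) = dist p (p + s *\<^sub>R a + t *\<^sub>R b)"
      by (metis add.assoc add_diff_cancel_left' dist_commute dist_norm)
    finally show ?thesis
      by simp
  qed
  have "((\<lambda>s. f (p + h *\<^sub>R b + s *\<^sub>R a) - f (p + s *\<^sub>R a)) has_real_derivative
      partial_deriv a f (p + h *\<^sub>R b + s *\<^sub>R a) - partial_deriv a f (p + s *\<^sub>R a)) (at s)"
    if "0 \<le> s" "s \<le> h" for s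
    using near[of s h] near[of s 0] that h sub
    by (intro DERIV_diff DERIV_along_line f) (auto simp: algebra_simps subset_iff)
  from MVT2[OF h this] obtain s where s: "0 < s" "s < h"
    and 1: "f (p + h *\<^sub>R b + h *\<^sub>R a) - f (p + h *\<^sub>R a) - (f (p + h *\<^sub>R b) - f p) =
      h * (partial_deriv a f (p + h *\<^sub>R b + s *\<^sub>R a) - partial_deriv a f (p + s *\<^sub>R a))"
    by auto
  have "((\<lambda>t. partial_deriv a f (p + s *\<^sub>R a + t *\<^sub>R b)) has_real_derivative
      partial_deriv b (partial_deriv a f) (p + s *\<^sub>R a + t *\<^sub>R b)) (at t)"
    if "0 \<le> t" "t \<le> h" for t
    using near[of s t] that s sub by (intro DERIV_along_line fa) auto
  from MVT2[OF h this] obtain t where t: "0 < t" "t < h"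
    and 2: "partial_deriv a f (p + s *\<^sub>R a + h *\<^sub>R b) - partial_deriv a f (p + s *\<^sub>R a) =
      h * partial_deriv b (partial_deriv a f) (p + s *\<^sub>R a + t *\<^sub>R b)"
    by auto
  show ?thesis
    using near[of s t] s t 1 2
    by (intro bexI[of _ "p + s *\<^sub>R a + t *\<^sub>R b"]) (simp_all add: algebra_simps)
qed

lemma Cn_on_2_iff:
  "Cn_on 2 S f \<longleftrightarrow> twice_differentiable_on S f \<and>
     (\<forall>a\<in>Basis. \<forall>b\<in>Basis. continuous_on S (partial_deriv b (partial_deriv a f)))"
  by (auto simp: numeral_2_eq_2 twice_differentiable_on_def)

text \<open>
  If the two mixed derivatives differed at \<open>p\<close>, continuity would keep their values on a small ball
  around \<open>p\<close> apart. But by the mean value formula, used in both orders, a value of one of them on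
  the ball equals a value of the other, possibly at another point.
\<close>

lemma partial_deriv_commute:
  assumes "open S" "p \<in> S" and C2: "Cn_on 2 S f" and ab: "a \<in> Basis" "b \<in> Basis"
  shows "partial_deriv b (partial_deriv a f) p = partial_deriv a (partial_deriv b f) p"
proof (rule ccontr)
  let ?g = "partial_deriv b (partial_deriv a f)" and ?h = "partial_deriv a (partial_deriv b f)"
  have diff: "f differentiable (at q)" "partial_deriv a f differentiable (at q)"
    "partial_deriv b f differentiable (at q)" if "q \<in> S" for q
    using C2 ab that by (auto simp: Cn_on_2_iff twice_differentiable_on_def)
  have "continuous_on S ?g" "continuous_on S ?h"
    using C2 ab by (auto simp: Cn_on_2_iff)
  then have "isCont ?g p" "isCont ?h p"
    using \<open>open S\<close> \<open>p \<in> S\<close> by (auto simp: continuous_on_eq_continuous_at)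
  define e where "e = \<bar>?g p - ?h p\<bar> / 2"
  assume "?g p \<noteq> ?h p"
  then have "e > 0"
    by (simp add: e_def)
  obtain d1 where d1: "d1 > 0" "\<And>q. dist q p < d1 \<Longrightarrow> \<bar>?g q - ?g p\<bar> < e"
    using \<open>isCont ?g p\<close> \<open>e > 0\<close> unfolding continuous_at_eps_delta dist_real_def by blast
  obtain d2 where d2: "d2 > 0" "\<And>q. dist q p < d2 \<Longrightarrow> \<bar>?h q - ?h p\<bar> < e"
    using \<open>isCont ?h p\<close> \<open>e > 0\<close> unfolding continuous_at_eps_delta dist_real_def by blast
  obtain d3 where d3: "d3 > 0" "cball p d3 \<subseteq> S"
    using \<open>open S\<close> \<open>p \<in> S\<close> by (auto simp: open_contains_cball)
  (* the points of the mean value formula lie within 2 h of p *)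
  define h where "h = min d1 (min d2 d3) / 3"
  have h: "0 < h" "2 * h < d1" "2 * h < d2" "2 * h < d3"
    using d1(1) d2(1) d3(1) by (auto simp: h_def)
  have sub: "cball p (2 * h) \<subseteq> S"
    using d3(2) h by (auto intro: order_trans[OF subset_cball])
  let ?\<Delta> = "f (p + h *\<^sub>R a + h *\<^sub>R b) - f (p + h *\<^sub>R a) - f (p + h *\<^sub>R b) + f p"
  obtain q1 where q1: "q1 \<in> cball p (2 * h)" "?\<Delta> = h * h * ?g q1"
    using second_difference_mean_value[OF h(1) _ _ sub, of a b f] diff ab by auto
  obtain q2 where q2: "q2 \<in> cball p (2 * h)" "?\<Delta> = h * h * ?h q2"
    using second_difference_mean_value[OF h(1) _ _ sub, of b a f] diff ab
    by (auto simp: algebra_simps)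
  have "?g q1 = ?h q2"
    using q1(2) q2(2) h(1) by simp
  moreover have "\<bar>?g q1 - ?g p\<bar> < e" "\<bar>?h q2 - ?h p\<bar> < e"
    using q1(1) q2(1) h by (auto intro!: d1(2) d2(2) simp: dist_commute)
  ultimately have "\<bar>?g p - ?h p\<bar> < 2 * e"
    by linarith
  then show False
    by (simp add: e_def)
qed


section \<open>The Legendre map and its inverse\<close>

lemma E_classD:
  assumes "u \<in> E_class \<Omega>"
  shows "Cn_on 2 \<Omega> u"
    and "\<And>p. p \<in> \<Omega> \<Longrightarrow> pos_definite (D2xx u p)"
    and "\<And>p. p \<in> \<Omega> \<Longrightarrow> neg_definite (D2yy u p)"
  using assms by (auto simp: E_class_def smooth_on_def)

lemma legendre_map_alt: "legendre_map u = (\<lambda>p. (fst p, grad_y u p))"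
  by (auto simp: legendre_map_def fun_eq_iff)

lemma has_derivative_partial_deriv_ex:
  assumes "partial_deriv (ex i) u differentiable (at p)"
  shows "(partial_deriv (ex i) u has_derivative
    (\<lambda>v. (D2xx u p *v fst v + D2xy u p *v snd v) $ i)) (at p)"
proof -
  have "frechet_derivative (partial_deriv (ex i) u) (at p) =
      (\<lambda>v. (D2xx u p *v fst v + D2xy u p *v snd v) $ i)"
    using frechet_derivative_eq_partial_derivs[OF assms]
    by (auto simp: fun_eq_iff D2xx_def D2xy_def matrix_vector_mult_def)
  then show ?thesis
    using assms by (simp add: frechet_derivative_works)
qed

text \<open>
  The matrix \<open>D2yx\<close> is the transpose of \<open>D2xy\<close>, whose entries differentiate in \<open>x\<close> first; here the
  gradient in \<open>y\<close> is differentiated in \<open>x\<close>, and the two orders must be exchanged.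
\<close>

lemma has_derivative_grad_y:
  assumes "open \<Omega>" "p \<in> \<Omega>" and C2: "Cn_on 2 \<Omega> u"
  shows "(grad_y u has_derivative (\<lambda>v. D2yx u p *v fst v + D2yy u p *v snd v)) (at p)"
proof -
  have "(partial_deriv (ey j) u has_derivative
      (\<lambda>v. (D2yx u p *v fst v + D2yy u p *v snd v) $ j)) (at p)" for j
  proof -
    have diff: "partial_deriv (ey j) u differentiable (at p)"
      using C2 \<open>p \<in> \<Omega>\<close> by (auto simp: Cn_on_2_iff twice_differentiable_on_def coord_vec_in_Basis)
    have "partial_deriv (ex i) (partial_deriv (ey j) u) p =
        partial_deriv (ey j) (partial_deriv (ex i) u) p" for i
      using assms by (intro partial_deriv_commute) (auto simp: coord_vec_in_Basis)
    then have "frechet_derivative (partial_deriv (ey j) u) (at p) =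
        (\<lambda>v. (D2yx u p *v fst v + D2yy u p *v snd v) $ j)"
      using frechet_derivative_eq_partial_derivs[OF diff]
      by (auto simp: fun_eq_iff D2yx_def D2xy_def D2yy_def transpose_def matrix_vector_mult_def)
    then show ?thesis
      using diff by (simp add: frechet_derivative_works)
  qed
  then show ?thesis
    unfolding has_derivative_componentwise_within[of "grad_y u"]
    by (auto simp: Basis_vec_def inner_axis grad_y_def)
qed

lemma has_derivative_legendre_map:
  assumes "open \<Omega>" "p \<in> \<Omega>" "Cn_on 2 \<Omega> u"
  shows "(legendre_map u has_derivative (\<lambda>v. (fst v, D2yx u p *v fst v + D2yy u p *v snd v))) (at p)"
  unfolding legendre_map_alt
  by (intro has_derivative_Pair has_derivative_grad_y[OF assms] has_derivative_fst
      has_derivative_ident)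

context
  fixes \<Omega> :: "((real^'k::finite) \<times> (real^'l::finite)) set"
    and u :: "(real^'k) \<times> (real^'l) \<Rightarrow> real"
  assumes \<Omega>: "open \<Omega>" and u: "u \<in> E_class \<Omega>" and inj: "inj_on (legendre_map u) \<Omega>"
begin

lemma continuous_on_legendre_map: "continuous_on \<Omega> (legendre_map u)"
  using has_derivative_legendre_map[OF \<Omega> _ E_classD(1)[OF u]]
  by (meson continuous_at_imp_continuous_on has_derivative_continuous)

lemma open_legendre_image: "open (legendre_map u ` \<Omega>)"
  by (rule invariance_of_domain[OF continuous_on_legendre_map \<Omega> inj])

text \<open>
  Injectivity makes the inverse continuous, again by invariance of domain; the derivative of the inverse then comes from
  solving \<open>u\<^sub>y\<^sub>x h + u\<^sub>y\<^sub>y m = k\<close> for \<open>m\<close>, which the definiteness of \<open>u\<^sub>y\<^sub>y\<close> permits.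
\<close>

lemma has_derivative_inverse_legendre_map:
  assumes p: "p \<in> \<Omega>"
  shows "(inv_into \<Omega> (legendre_map u) has_derivative
    (\<lambda>v. (fst v, matrix_inv (D2yy u p) *v (snd v - D2yx u p *v fst v)))) (at (legendre_map u p))"
proof (rule has_derivative_inverse_dieudonne[OF \<Omega> open_legendre_image continuous_on_legendre_map
      _ _ p has_derivative_legendre_map[OF \<Omega> p E_classD(1)[OF u]]])
  let ?F = "legendre_map u" and ?G = "inv_into \<Omega> (legendre_map u)"
  show "?G (?F q) = q" if "q \<in> \<Omega>" for q
    using inj that by simp
  then show "continuous_on (?F ` \<Omega>) ?G"
    by (intro continuous_on_inverse_open[OF \<Omega> continuous_on_legendre_map]) auto
  show "bounded_linear (\<lambda>v. (fst v, matrix_inv (D2yy u p) *v (snd v - D2yx u p *v fst v)))"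
    by (intro bounded_linear_Pair bounded_linear_fst
        bounded_linear_compose[OF matrix_vector_mul_bounded_linear] bounded_linear_sub
        bounded_linear_snd)
  have "invertible (D2yy u p)"
    by (intro neg_definite_invertible E_classD(3)[OF u p])
  then show "(\<lambda>v. (fst v, matrix_inv (D2yy u p) *v (snd v - D2yx u p *v fst v))) \<circ>
      (\<lambda>v. (fst v, D2yx u p *v fst v + D2yy u p *v snd v)) = id"
    by (auto simp: fun_eq_iff matrix_vector_mul_assoc matrix_inv_inverse)
qed


section \<open>Derivatives of the transform\<close>

lemma partial_legendre_eq:
  assumes "q \<in> legendre_map u ` \<Omega>"
  defines "p \<equiv> inv_into \<Omega> (legendre_map u) q"
  shows "partial_legendre \<Omega> u q = u p - snd p \<bullet> snd q"
proof -
  have p: "p \<in> \<Omega>" "legendre_map u p = q"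
    using assms by (auto simp: inv_into_into f_inv_into_f)
  obtain x y where xy: "p = (x, y)"
    by (cases p)
  then have q: "q = (x, grad_y u (x, y))"
    using p by (simp add: legendre_map_def)
  have "(THE y'. (x, y') \<in> \<Omega> \<and> grad_y u (x, y') = snd q) = y"
    using p inj by (auto simp: xy q legendre_map_def inj_on_def intro!: the_equality)
  then show ?thesis
    by (simp add: partial_legendre_def q xy)
qed

text \<open>
  Since \<open>z = u\<^sub>y\<close>, the variation of \<open>y\<close> contributes \<open>u\<^sub>y dy\<close> through the first summand of \<open>w\<close>
  and \<open>- z dy\<close> through the second, and these cancel.
\<close>

lemma has_derivative_partial_legendre:
  assumes p: "p \<in> \<Omega>"
  shows "(partial_legendre \<Omega> u has_derivative
    (\<lambda>v. (\<Sum>i\<in>UNIV. partial_deriv (ex i) u p * fst v $ i) - snd p \<bullet> snd v)) (at (legendre_map u p))"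
proof -
  let ?F = "legendre_map u" and ?G = "inv_into \<Omega> (legendre_map u)"
  let ?m = "\<lambda>v. matrix_inv (D2yy u p) *v (snd v - D2yx u p *v fst v)"
  have GF: "?G (?F p) = p"
    using inj p by simp
  have snd_F: "snd (?F p) = grad_y u p"
    by (simp add: legendre_map_alt)
  note G = has_derivative_inverse_legendre_map[OF p]
  have diff: "u differentiable (at p)"
    using E_classD(1)[OF u] p by (auto simp: Cn_on_2_iff twice_differentiable_on_def)
  then have "(u has_derivative frechet_derivative u (at p)) (at (?G (?F p)))"
    by (simp add: frechet_derivative_works GF)
  from has_derivative_compose[OF G this]
  have "((\<lambda>q. u (?G q)) has_derivative (\<lambda>v. frechet_derivative u (at p) (fst v, ?m v))) (at (?F p))" .
  moreover have "((\<lambda>q. snd (?G q) \<bullet> snd q) has_derivative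
      (\<lambda>v. snd p \<bullet> snd v + ?m v \<bullet> grad_y u p)) (at (?F p))"
    using has_derivative_inner[OF has_derivative_snd[OF G] has_derivative_snd[OF has_derivative_ident]]
    by (simp add: GF snd_F)
  ultimately have "((\<lambda>q. u (?G q) - snd (?G q) \<bullet> snd q) has_derivative
      (\<lambda>v. frechet_derivative u (at p) (fst v, ?m v) - (snd p \<bullet> snd v + ?m v \<bullet> grad_y u p))) (at (?F p))"
    by (rule has_derivative_diff)
  also have "(\<lambda>v. frechet_derivative u (at p) (fst v, ?m v) - (snd p \<bullet> snd v + ?m v \<bullet> grad_y u p)) =
      (\<lambda>v. (\<Sum>i\<in>UNIV. partial_deriv (ex i) u p * fst v $ i) - snd p \<bullet> snd v)"
    by (auto simp: fun_eq_iff frechet_derivative_eq_partial_derivs[OF diff] inner_vec_def grad_y_def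
        mult.commute)
  finally show ?thesis
    by (rule has_derivative_transform_within_open[OF _ open_legendre_image])
      (use p in \<open>auto simp: partial_legendre_eq\<close>)
qed

text \<open>
  These identities hold on the whole open image, so they may be differentiated once more: no second
  derivative of the inverse map enters the Hessian.
\<close>

lemma partial_deriv_partial_legendre:
  assumes p: "p \<in> \<Omega>"
  shows "partial_deriv (ex i) (partial_legendre \<Omega> u) (legendre_map u p) = partial_deriv (ex i) u p"
    and "partial_deriv (ey j) (partial_legendre \<Omega> u) (legendre_map u p) = - snd p $ j"
  unfolding partial_deriv_eq[OF has_derivative_partial_legendre[OF p]]
  by (simp_all add: ex_ey_components inner_axis) (simp add: axis_def if_distrib cong: if_cong)

lemma has_derivative_partial_deriv_partial_legendre:
  assumes p: "p \<in> \<Omega>"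
  defines "J \<equiv> matrix_inv (D2yy u p)"
  shows "(partial_deriv (ex i) (partial_legendre \<Omega> u) has_derivative
      (\<lambda>v. (D2xx u p *v fst v + D2xy u p *v (J *v (snd v - D2yx u p *v fst v))) $ i))
      (at (legendre_map u p))"
    and "(partial_deriv (ey j) (partial_legendre \<Omega> u) has_derivative
      (\<lambda>v. - (J *v (snd v - D2yx u p *v fst v)) $ j)) (at (legendre_map u p))"
proof -
  let ?F = "legendre_map u" and ?G = "inv_into \<Omega> (legendre_map u)"
  have GF: "?G (?F q) = q" if "q \<in> \<Omega>" for q
    using inj that by simp
  note G = has_derivative_inverse_legendre_map[OF p, folded J_def]
  have "partial_deriv (ex i) u differentiable (at p)"
    using E_classD(1)[OF u] p by (auto simp: Cn_on_2_iff twice_differentiable_on_def coord_vec_in_Basis)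
  then have "(partial_deriv (ex i) u has_derivative
      (\<lambda>v. (D2xx u p *v fst v + D2xy u p *v snd v) $ i)) (at (?G (?F p)))"
    using has_derivative_partial_deriv_ex by (simp only: GF[OF p])
  from has_derivative_compose[OF G this, unfolded fst_conv snd_conv]
  show "(partial_deriv (ex i) (partial_legendre \<Omega> u) has_derivative
      (\<lambda>v. (D2xx u p *v fst v + D2xy u p *v (J *v (snd v - D2yx u p *v fst v))) $ i)) (at (?F p))"
    by (rule has_derivative_transform_within_open[OF _ open_legendre_image])
      (use p in \<open>auto simp: partial_deriv_partial_legendre GF\<close>)
  have "((\<lambda>q. - snd (?G q) $ j) has_derivative (\<lambda>v. - (J *v (snd v - D2yx u p *v fst v)) $ j)) (at (?F p))"
    using has_derivative_minus[OF bounded_linear.has_derivative[OF bounded_linear_vec_nth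
          has_derivative_snd[OF G]]]
    by simp
  then show "(partial_deriv (ey j) (partial_legendre \<Omega> u) has_derivative
      (\<lambda>v. - (J *v (snd v - D2yx u p *v fst v)) $ j)) (at (?F p))"
    by (rule has_derivative_transform_within_open[OF _ open_legendre_image])
      (use p in \<open>auto simp: partial_deriv_partial_legendre GF\<close>)
qed

lemma twice_differentiable_partial_legendre:
  "twice_differentiable_on (legendre_map u ` \<Omega>) (partial_legendre \<Omega> u)"
  unfolding twice_differentiable_on_def
proof (intro ballI conjI)
  fix q and b :: "(real^'k) \<times> (real^'l)"
  assume "q \<in> legendre_map u ` \<Omega>"
  then obtain p where p: "p \<in> \<Omega>" "q = legendre_map u p"
    by blast
  show "partial_legendre \<Omega> u differentiable (at q)"
    using has_derivative_partial_legendre[OF p(1)] p(2) unfolding differentiable_def by blast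
  assume "b \<in> Basis"
  then obtain a :: "'k + 'l" where b: "b = coord_vec a"
    by (auto simp: Basis_eq_range_coord_vec)
  show "partial_deriv b (partial_legendre \<Omega> u) differentiable (at q)"
    using has_derivative_partial_deriv_partial_legendre[OF p(1)] p(2)
    unfolding b differentiable_def by (cases a) auto
qed

lemma hessian_partial_legendre:
  assumes p: "p \<in> \<Omega>"
  shows "hessian (partial_legendre \<Omega> u) (legendre_map u p) =
    block_matrix (D2xx u p - D2xy u p ** matrix_inv (D2yy u p) ** D2yx u p)
      (D2xy u p ** matrix_inv (D2yy u p))
      (matrix_inv (D2yy u p) ** D2yx u p)
      (- matrix_inv (D2yy u p))"
  by (simp add: eq_block_matrix_iff hessian_def ex_ey_components matrix_mul_assoc
      partial_deriv_eq[OF has_derivative_partial_deriv_partial_legendre(1)[OF p]]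
      partial_deriv_eq[OF has_derivative_partial_deriv_partial_legendre(2)[OF p]]
      uminus_matrix_vector_mult matrix_vector_mul_assoc matrix_vector_mult_axis_nth)

end


section \<open>The Hessian of the partial Legendre transform\<close>

theorem proposition2p3:
  fixes \<Omega> :: "((real^'k::finite) \<times> (real^'l::finite)) set"
    and u :: "(real^'k) \<times> (real^'l) \<Rightarrow> real"
  assumes "open \<Omega>"
    and "u \<in> E_class \<Omega>"
    and "inj_on (legendre_map u) \<Omega>"
  shows "open (legendre_map u ` \<Omega>) \<and>
    twice_differentiable_on (legendre_map u ` \<Omega>) (partial_legendre \<Omega> u) \<and>
    (\<forall>x y. (x, y) \<in> \<Omega> \<longrightarrow>
      (let p = (x, y);
           H = hessian (partial_legendre \<Omega> u) (x, grad_y u (x, y))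
       in
         H = block_matrix
               (D2xx u p - D2xy u p ** matrix_inv (D2yy u p) ** D2yx u p)
               (D2xy u p ** matrix_inv (D2yy u p))
               (matrix_inv (D2yy u p) ** D2yx u p)
               (- matrix_inv (D2yy u p)) \<and>
         pos_semidefinite H \<and>
         det H = det (D2xx u p) / det (- D2yy u p)))"
proof (intro conjI allI impI)
  show "open (legendre_map u ` \<Omega>)"
    by (rule open_legendre_image[OF assms])
  show "twice_differentiable_on (legendre_map u ` \<Omega>) (partial_legendre \<Omega> u)"
    by (rule twice_differentiable_partial_legendre[OF assms])
  fix x y
  assume p: "(x, y) \<in> \<Omega>"
  let ?p = "(x, y)"
  let ?J = "matrix_inv (D2yy u ?p)"
  let ?H = "hessian (partial_legendre \<Omega> u) (x, grad_y u ?p)"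
  have H: "?H = block_matrix (D2xx u ?p - D2xy u ?p ** ?J ** D2yx u ?p) (D2xy u ?p ** ?J)
      (?J ** D2yx u ?p) (- ?J)"
    using hessian_partial_legendre[OF assms p] by (simp add: legendre_map_def)
  have neg: "neg_definite (D2yy u ?p)"
    using E_classD(3)[OF assms(2) p] .
  have "pos_semidefinite ?H"
    unfolding H D2yx_def
    by (intro pos_semidefinite_legendre_block E_classD(2)[OF assms(2) p] neg_definite_matrix_inv neg)
  moreover have "(- D2yy u ?p) ** (- ?J) = mat 1"
    using matrix_inv_inverse(1)[OF neg_definite_invertible[OF neg]] by (simp add: matrix_mult_uminus)
  then have "det (- D2yy u ?p) * det (- ?J) = 1"
    by (metis det_I det_mul)
  then have "det (- ?J) = 1 / det (- D2yy u ?p)"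
    by (metis mult_zero_left nonzero_eq_divide_eq mult.commute zero_neq_one)
  then have "det ?H = det (D2xx u ?p) / det (- D2yy u ?p)"
    by (simp add: H det_legendre_block)
  ultimately show "let p = (x, y); H = hessian (partial_legendre \<Omega> u) (x, grad_y u (x, y)) in
      H = block_matrix
        (D2xx u p - D2xy u p ** matrix_inv (D2yy u p) ** D2yx u p)
        (D2xy u p ** matrix_inv (D2yy u p))
        (matrix_inv (D2yy u p) ** D2yx u p)
        (- matrix_inv (D2yy u p)) \<and>
      pos_semidefinite H \<and> det H = det (D2xx u p) / det (- D2yy u p)"
    using H by (simp add: Let_def)
qed

end
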